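(* Let $I=[a,b]\subset\mathbb{R}$ be a compact interval and let $f:I\to\mathbb{R}$. Then $f$ is ($\epsilon$-$\delta$) Henstock integrable on $I$ if and only if $f$ is Sequential Henstock integrable on $I$, and in that case the two integrals of $f$ on $I$ have the same value.
   Context: A tagged partition $P=\{([x_{i-1},x_i],t_i)\}_{i=1}^k$ of $I=[a,b]$ consists of points $a=x_0<x_1<\dots<x_k=b$ together with tags $t_i\in[x_{i-1},x_i]$, $i=1,\dots,k$. Its Riemann sum for $f$ is $S(f,P)=\sum_{i=1}^k f(t_i)(x_i-x_{i-1})$. A gauge on $I$ is a function $\delta:I\to\mathbb{R}$ with $\delta(x)>0$ for all $x\in I$. $P$ is $\delta(x)$-fine if $x_i-x_{i-1}<\delta(t_i)$ for every $i$. $f$ is ($\epsilon$-$\delta$) Henstock integrable on $I$ with integral $A\in\mathbb{R}$ if for each $\epsilon>0$ there is a gauge $\delta$ on $I$ such that $|S(f,P)-A|<\epsilon$ for all $\delta(x)$-fine tagged partitions $P$ of $I$. $f$ is Sequential Henstock integrable on $I$ with integral $A\in\mathbb{R}$ if there is a sequence of gauges $\{\delta_n\}_{n=1}^\infty$ on $I$ such that, whenever $P_n$ is a $\delta_n(x)$-fine tagged partition of $I$ for each $n$, one has $S(f,P_n)\to A$ as $n\to\infty$. *)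

theory Defs
  imports Complex_Main
begin

text \<open>
  A term \<open>TP k x t\<close> represents the partition with division points \<open>x 0, \<dots>, x k\<close> and tags
  \<open>t 1, \<dots>, t k\<close>. The values of \<open>x\<close> beyond \<open>k\<close>, and of \<open>t\<close> outside \<open>{1..k}\<close>, are irrelevant.
\<close>

datatype tagged_partition =
  TP (parts: nat) (point: "nat \<Rightarrow> real") (tag: "nat \<Rightarrow> real")

text \<open>
  The case \<open>parts P = 0\<close> is the empty partition; it is possible only if \<open>a = b\<close>, and it is
  the only tagged partition of such a degenerate interval.
\<close>

definition tagged_partition_of :: "tagged_partition \<Rightarrow> real \<Rightarrow> real \<Rightarrow> bool" where
  "tagged_partition_of P a b \<longleftrightarrow>
     point P 0 = a \<and> point P (parts P) = b \<and>
     (\<forall>i\<in>{1..parts P}. point P (i - 1) < point P i) \<and>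
     (\<forall>i\<in>{1..parts P}. tag P i \<in> {point P (i - 1)..point P i})"

definition riemann_sum :: "(real \<Rightarrow> real) \<Rightarrow> tagged_partition \<Rightarrow> real" where
  "riemann_sum f P = (\<Sum>i=1..parts P. f (tag P i) * (point P i - point P (i - 1)))"

text \<open>
  Gauges here are positive functions, as opposed to the set-valued \<open>gauge\<close> of HOL-Analysis,
  and fineness bounds the length of each subinterval.
\<close>

definition gauge_on :: "real \<Rightarrow> real \<Rightarrow> (real \<Rightarrow> real) \<Rightarrow> bool" where
  "gauge_on a b \<delta> \<longleftrightarrow> (\<forall>x\<in>{a..b}. 0 < \<delta> x)"

definition gauge_fine :: "(real \<Rightarrow> real) \<Rightarrow> tagged_partition \<Rightarrow> bool" where
  "gauge_fine \<delta> P \<longleftrightarrow> (\<forall>i\<in>{1..parts P}. point P i - point P (i - 1) < \<delta> (tag P i))"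

definition has_henstock_integral :: "(real \<Rightarrow> real) \<Rightarrow> real \<Rightarrow> real \<Rightarrow> real \<Rightarrow> bool" where
  "has_henstock_integral f a b A \<longleftrightarrow>
     (\<forall>\<epsilon>>0. \<exists>\<delta>. gauge_on a b \<delta> \<and>
        (\<forall>P. tagged_partition_of P a b \<and> gauge_fine \<delta> P \<longrightarrow> \<bar>riemann_sum f P - A\<bar> < \<epsilon>))"

definition henstock_integrable :: "(real \<Rightarrow> real) \<Rightarrow> real \<Rightarrow> real \<Rightarrow> bool" where
  "henstock_integrable f a b \<longleftrightarrow> (\<exists>A. has_henstock_integral f a b A)"

definition has_seq_henstock_integral :: "(real \<Rightarrow> real) \<Rightarrow> real \<Rightarrow> real \<Rightarrow> real \<Rightarrow> bool" where
  "has_seq_henstock_integral f a b A \<longleftrightarrow>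
     (\<exists>\<delta> :: nat \<Rightarrow> real \<Rightarrow> real. (\<forall>n. gauge_on a b (\<delta> n)) \<and>
        (\<forall>P. (\<forall>n. tagged_partition_of (P n) a b \<and> gauge_fine (\<delta> n) (P n)) \<longrightarrow>
             (\<lambda>n. riemann_sum f (P n)) \<longlonglongrightarrow> A))"

definition seq_henstock_integrable :: "(real \<Rightarrow> real) \<Rightarrow> real \<Rightarrow> real \<Rightarrow> bool" where
  "seq_henstock_integrable f a b \<longleftrightarrow> (\<exists>A. has_seq_henstock_integral f a b A)"

end

theory Submission
  imports Defs
begin

text \<open>
  A number \<open>A\<close> is a Henstock integral of \<open>f\<close> exactly when it is a sequential one, which gives
  the equivalence (\<open>has_henstock_integral_iff_seq\<close>). Gauges that witness
  the errors \<open>1 / (n + 1)\<close> form a suitable sequence. Conversely, if a sequence of gauges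
  \<open>\<delta>\<^sub>n\<close> witnesses \<open>A\<close> but the \<open>\<epsilon>\<close>-\<open>\<delta>\<close> condition fails for some \<open>\<epsilon>\<close>, then none of the \<open>\<delta>\<^sub>n\<close>
  works for this \<open>\<epsilon>\<close>; choosing a bad \<open>\<delta>\<^sub>n\<close>-fine partition for every \<open>n\<close> gives Riemann sums
  that stay at distance at least \<open>\<epsilon>\<close> from their supposed limit.

  It remains to see that a function has at most one Henstock integral
  (\<open>has_henstock_integral_unique\<close>). This is where the existence of
  fine partitions enters: by Cousin's lemma (\<open>cousin\<close>), two gauges, one for each of two candidate
  values, admit a common fine partition, whose Riemann sum is close to both values.
\<close>

lemma tagged_partition_append:
  assumes "tagged_partition_of P a b" "gauge_fine \<delta> P"
    and "tagged_partition_of Q b c" "gauge_fine \<delta> Q"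
  shows "\<exists>R. tagged_partition_of R a c \<and> gauge_fine \<delta> R"
proof -
  define m where "m = parts P"
  define x where "x i = (if i \<le> m then point P i else point Q (i - m))" for i
  define t where "t i = (if i \<le> m then tag P i else tag Q (i - m))" for i
  define R where "R = TP (m + parts Q) x t"
  \<comment> \<open>at \<open>i = m\<close> both branches give the common endpoint \<open>b\<close>, so the cell after \<open>m\<close> starts in \<open>Q\<close>\<close>
  have x_right: "x i = point Q (i - m)" if "m \<le> i" for i
    using that assms(1,3) by (auto simp: x_def m_def tagged_partition_of_def)
  have cell: "x (i - 1) < x i \<and> t i \<in> {x (i - 1)..x i} \<and> x i - x (i - 1) < \<delta> (t i)"
    if i: "i \<in> {1..m + parts Q}" for i
  proof (cases "i \<le> m")
    case True
    then have "i \<in> {1..parts P}" using i by (simp add: m_def)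
    moreover have "x i = point P i" "x (i - 1) = point P (i - 1)" "t i = tag P i"
      using True by (auto simp: x_def t_def)
    ultimately show ?thesis
      using assms(1,2) unfolding tagged_partition_of_def gauge_fine_def by metis
  next
    case False
    then have "i - m \<in> {1..parts Q}" using i by auto
    moreover have "x i = point Q (i - m)" "x (i - 1) = point Q (i - m - 1)" "t i = tag Q (i - m)"
      using False by (auto simp: x_right t_def)
    ultimately show ?thesis
      using assms(3,4) unfolding tagged_partition_of_def gauge_fine_def by metis
  qed
  have "x 0 = a" "x (m + parts Q) = c"
    using assms(1,3) by (auto simp: x_right, auto simp: x_def tagged_partition_of_def)
  with cell have "tagged_partition_of R a c" "gauge_fine \<delta> R"
    by (auto simp: R_def tagged_partition_of_def gauge_fine_def)
  then show ?thesis by blast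
qed

text \<open>
  Cousin's lemma, by bisection: having a fine partition is stable under concatenating intervals,
  and it holds for every interval around \<open>x\<close> that is shorter than \<open>\<delta> x\<close>, with \<open>x\<close> as its only tag.
\<close>

lemma cousin:
  assumes "a \<le> b" and "gauge_on a b \<delta>"
  shows "\<exists>P. tagged_partition_of P a b \<and> gauge_fine \<delta> P"
  using \<open>a \<le> b\<close>
proof (induction rule: Bolzano)
  case (trans u v w)
  then show ?case using tagged_partition_append by blast
next
  case (local x)
  have "\<exists>P. tagged_partition_of P u v \<and> gauge_fine \<delta> P"
    if "u \<le> x" "x \<le> v" "v - u < \<delta> x" for u v
  proof (cases "u = v")
    \<comment> \<open>the cells of a partition are nondegenerate, so a single point only has the empty one\<close>
    case True
    then have "tagged_partition_of (TP 0 (\<lambda>_. u) (\<lambda>_. x)) u v"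
        "gauge_fine \<delta> (TP 0 (\<lambda>_. u) (\<lambda>_. x))"
      by (auto simp: tagged_partition_of_def gauge_fine_def)
    then show ?thesis by blast
  next
    case False
    define P where "P = TP 1 (\<lambda>i. if i = 0 then u else v) (\<lambda>_. x)"
    have "tagged_partition_of P u v" "gauge_fine \<delta> P"
      using that False by (auto simp: P_def tagged_partition_of_def gauge_fine_def)
    then show ?thesis by blast
  qed
  moreover have "\<delta> x > 0" using local assms(2) by (auto simp: gauge_on_def)
  ultimately show ?case by blast
qed

lemma has_henstock_integral_unique:
  assumes "a \<le> b" and A: "has_henstock_integral f a b A" and B: "has_henstock_integral f a b B"
  shows "A = B"
proof (rule ccontr)
  assume "A \<noteq> B"
  define \<epsilon> where "\<epsilon> = \<bar>A - B\<bar> / 2"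
  have "\<epsilon> > 0" using \<open>A \<noteq> B\<close> by (simp add: \<epsilon>_def)
  obtain \<gamma> where \<gamma>: "gauge_on a b \<gamma>"
    and near_A: "\<And>P. tagged_partition_of P a b \<Longrightarrow> gauge_fine \<gamma> P \<Longrightarrow> \<bar>riemann_sum f P - A\<bar> < \<epsilon>"
    using A \<open>\<epsilon> > 0\<close> unfolding has_henstock_integral_def by blast
  obtain \<eta> where \<eta>: "gauge_on a b \<eta>"
    and near_B: "\<And>P. tagged_partition_of P a b \<Longrightarrow> gauge_fine \<eta> P \<Longrightarrow> \<bar>riemann_sum f P - B\<bar> < \<epsilon>"
    using B \<open>\<epsilon> > 0\<close> unfolding has_henstock_integral_def by blast
  have "gauge_on a b (\<lambda>x. min (\<gamma> x) (\<eta> x))"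
    using \<gamma> \<eta> by (simp add: gauge_on_def)
  from cousin[OF \<open>a \<le> b\<close> this] obtain P
    where P: "tagged_partition_of P a b" "gauge_fine (\<lambda>x. min (\<gamma> x) (\<eta> x)) P"
    by blast
  then have "gauge_fine \<gamma> P" "gauge_fine \<eta> P"
    by (auto simp: gauge_fine_def)
  then have "\<bar>riemann_sum f P - A\<bar> < \<epsilon>" "\<bar>riemann_sum f P - B\<bar> < \<epsilon>"
    using near_A near_B P(1) by auto
  then show False unfolding \<epsilon>_def by argo
qed

lemma has_henstock_integral_iff_seq:
  "has_henstock_integral f a b A \<longleftrightarrow> has_seq_henstock_integral f a b A"
proof
  assume A: "has_henstock_integral f a b A"
  have "\<exists>\<delta>. gauge_on a b \<delta> \<and> (\<forall>P. tagged_partition_of P a b \<and> gauge_fine \<delta> P \<longrightarrow>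
      \<bar>riemann_sum f P - A\<bar> < inverse (real (Suc n)))" for n
    using A by (simp add: has_henstock_integral_def del: of_nat_Suc)
  then obtain \<delta> where \<delta>: "\<And>n. gauge_on a b (\<delta> n)"
    and near: "\<And>n P. tagged_partition_of P a b \<Longrightarrow> gauge_fine (\<delta> n) P \<Longrightarrow>
      \<bar>riemann_sum f P - A\<bar> < inverse (real (Suc n))"
    by metis
  have "(\<lambda>n. riemann_sum f (P n)) \<longlonglongrightarrow> A"
    if P: "\<forall>n. tagged_partition_of (P n) a b \<and> gauge_fine (\<delta> n) (P n)" for P
  proof (rule metric_tendsto_imp_tendsto[OF LIMSEQ_inverse_real_of_nat])
    show "\<forall>\<^sub>F n in sequentially. dist (riemann_sum f (P n)) A \<le> dist (inverse (real (Suc n))) 0"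
      using near P by (intro always_eventually allI) (simp add: dist_real_def less_imp_le del: of_nat_Suc)
  qed
  with \<delta> show "has_seq_henstock_integral f a b A"
    unfolding has_seq_henstock_integral_def by blast
next
  assume "has_seq_henstock_integral f a b A"
  then obtain \<delta> where \<delta>: "\<And>n. gauge_on a b (\<delta> n)"
    and lim: "\<And>P. \<forall>n. tagged_partition_of (P n) a b \<and> gauge_fine (\<delta> n) (P n) \<Longrightarrow>
      (\<lambda>n. riemann_sum f (P n)) \<longlonglongrightarrow> A"
    unfolding has_seq_henstock_integral_def by blast
  show "has_henstock_integral f a b A"
  proof (rule ccontr)
    assume "\<not> has_henstock_integral f a b A"
    then obtain \<epsilon> where "\<epsilon> > 0"
      and bad: "\<And>\<gamma>. gauge_on a b \<gamma> \<Longrightarrow>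
        \<exists>P. tagged_partition_of P a b \<and> gauge_fine \<gamma> P \<and> \<not> \<bar>riemann_sum f P - A\<bar> < \<epsilon>"
      unfolding has_henstock_integral_def by blast
    obtain P where P: "\<And>n. tagged_partition_of (P n) a b \<and> gauge_fine (\<delta> n) (P n)"
      and far: "\<And>n. \<not> \<bar>riemann_sum f (P n) - A\<bar> < \<epsilon>"
      using bad[OF \<delta>] by metis
    from lim P have "(\<lambda>n. riemann_sum f (P n)) \<longlonglongrightarrow> A" by blast
    then have "\<forall>\<^sub>F n in sequentially. \<bar>riemann_sum f (P n) - A\<bar> < \<epsilon>"
      using \<open>\<epsilon> > 0\<close> by (auto dest: tendstoD simp: dist_real_def)
    with far show False by simp
  qed
qed

theorem theorem1:
  fixes f :: "real \<Rightarrow> real" and a b :: real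
  assumes "a \<le> b"
  shows "(henstock_integrable f a b \<longleftrightarrow> seq_henstock_integrable f a b) \<and>
         (\<forall>A B. has_henstock_integral f a b A \<and> has_seq_henstock_integral f a b B \<longrightarrow> A = B)"
  using has_henstock_integral_unique[OF assms]
  by (auto simp: henstock_integrable_def seq_henstock_integrable_def
      has_henstock_integral_iff_seq)

end
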